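(* Suppose $d_1\neq0$ and that the roots in $\mathbb C$ of the polynomials $P_3(x)$ and $P_6(x)$ are all distinct (i.e. $P_3P_6$ has nine pairwise distinct roots). If the linear differential equation $y''=R(x)y$ associated with the problem of motion of a heavy gyrostat with a fixed point in the Hess--Sretensky case has a liouvillian solution of type 2, then $$p_1=Bh\qquad\text{and}\qquad B=2A .$$
   Context: Let $A,B,p_1\in\mathbb R$, $h\in[-1,+\infty)$, $d_1\in(-1,0]$ be parameters. The problem of motion of a heavy gyrostat with a fixed point in the Hess--Sretensky case is described by the equation $$\frac{d^2u}{dx^2}+a(x)\frac{du}{dx}+b(x)u=0,\qquad a=\frac{P_9}{xP_6P_3},\quad b=\frac{P_3Q_3}{4x^2P_6},$$ $$P_3=2d_1x^3+(B-2A)x^2+2(Bh-p_1),\qquad Q_3=4d_1x^3-P_3,$$ $$P_6=x^6+(B^2-4h)x^4+4\bigl(h^2-1-B(Bh-p_1)\bigr)x^2+4(Bh-p_1)^2,\qquad P_9=(P_3-xP_3')P_6+\tfrac12xP_3P_6'.$$ The substitution $y=u\exp\left(\frac12\int a\,dx\right)$ brings it to the form $y''=R(x)y$ with $R=\frac12a'+\frac14a^2-b\in\mathbb C(x)$. Types of liouvillian solutions of $y''=Ry$, $R\in\mathbb C(x)$ (Kovacic): - type 1: a solution $\eta=\exp\left(\int\omega\,dx\right)$ with $\omega\in\mathbb C(x)$; - type 2: a solution $\eta=\exp\left(\int\omega\,dx\right)$ with $\omega$ algebraic of degree 2 over $\mathbb C(x)$, in the situation when there is no solution of type 1. *)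

theory Defs
  imports "HOL-Complex_Analysis.Complex_Analysis"
    "HOL-Computational_Algebra.Polynomial_Factorial"
    "HOL-Computational_Algebra.Field_as_Ring"
begin

section \<open>The differential field of rational functions\<close>

type_synonym ratfun = "complex poly fract"

lemma rat_deriv_well_defined:
  fixes a b c d :: "complex poly"
  assumes e: "a * d = c * b"
  shows "(pderiv a * b - a * pderiv b) * (d * d) = (pderiv c * d - c * pderiv d) * (b * b)"
proof -
  have "pderiv a * d + a * pderiv d = pderiv c * b + c * pderiv b"
    using arg_cong[OF e, of pderiv] by (simp only: pderiv_mult mult.commute add.commute)
  with e show ?thesis by algebra
qed

definition rat_deriv :: "ratfun \<Rightarrow> ratfun"
  where "rat_deriv r = (let (p, q) = quot_of_fract r
    in Fraction_Field.Fract (pderiv p * q - p * pderiv q) (q\<^sup>2))"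

lemma rat_deriv_Fract:
  assumes "q \<noteq> 0"
  shows "rat_deriv (Fraction_Field.Fract p q) =
    Fraction_Field.Fract (pderiv p * q - p * pderiv q) (q\<^sup>2)"
proof -
  obtain a b where ab: "quot_of_fract (Fraction_Field.Fract p q) = (a, b)"
    by (metis surj_pair)
  have b: "b \<noteq> 0" using snd_quot_of_fract_nonzero ab by (metis snd_conv)
  have "Fraction_Field.Fract a b = Fraction_Field.Fract p q"
    using ab by (metis Fract_quot_of_fract fst_conv snd_conv)
  then have "a * q = p * b" using b assms by (simp add: eq_fract)
  from rat_deriv_well_defined[OF this] show ?thesis
    using assms b by (simp add: rat_deriv_def ab eq_fract power2_eq_square)
qed

text \<open>Since \<^const>\<open>quot_of_fract\<close> is in lowest terms, \<open>rat_poles r\<close> is the set of genuine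
  poles of \<open>r\<close>, and \<open>rat_eval r z\<close> is the value of \<open>r\<close> at any other point \<open>z\<close>.\<close>

definition rat_poles :: "ratfun \<Rightarrow> complex set"
  where "rat_poles r = {z. poly (snd (quot_of_fract r)) z = 0}"

definition rat_eval :: "ratfun \<Rightarrow> complex \<Rightarrow> complex"
  where "rat_eval r z = poly (fst (quot_of_fract r)) z / poly (snd (quot_of_fract r)) z"

section \<open>Liouvillian solutions of \<open>y'' = R y\<close>\<close>

definition domain_in_plane :: "complex set \<Rightarrow> bool"
  where "domain_in_plane U \<longleftrightarrow> open U \<and> connected U \<and> U \<noteq> {}"

definition solves_on :: "ratfun \<Rightarrow> complex set \<Rightarrow> (complex \<Rightarrow> complex) \<Rightarrow> bool"
  where "solves_on R U y \<longleftrightarrow> y holomorphic_on U \<and> U \<inter> rat_poles R = {} \<and>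
    (\<forall>z\<in>U. deriv (deriv y) z = rat_eval R z * y z)"

text \<open>\<open>\<eta> = exp (\<integral>\<omega> dx)\<close> for some branch \<open>W\<close> of the indefinite integral.\<close>

definition exp_integral_on ::
  "complex set \<Rightarrow> (complex \<Rightarrow> complex) \<Rightarrow> (complex \<Rightarrow> complex) \<Rightarrow> bool"
  where "exp_integral_on U \<omega> \<eta> \<longleftrightarrow>
    (\<exists>W. \<forall>z\<in>U. (W has_field_derivative \<omega> z) (at z) \<and> \<eta> z = exp (W z))"

definition rational_on :: "complex set \<Rightarrow> (complex \<Rightarrow> complex) \<Rightarrow> bool"
  where "rational_on U \<omega> \<longleftrightarrow> (\<exists>r. U \<inter> rat_poles r = {} \<and> (\<forall>z\<in>U. \<omega> z = rat_eval r z))"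

text \<open>The irreducible polynomial \<open>m\<close> is, up to a factor in \<open>\<complex>(x)\<close>, the minimal polynomial
  of \<open>\<omega>\<close> over \<open>\<complex>(x)\<close>; its coefficients are evaluated at \<open>z\<close>.\<close>

definition algebraic_degree_on :: "nat \<Rightarrow> complex set \<Rightarrow> (complex \<Rightarrow> complex) \<Rightarrow> bool"
  where "algebraic_degree_on n U \<omega> \<longleftrightarrow>
    (\<exists>m :: ratfun poly. irreducible m \<and> degree m = n \<and>
      (\<forall>i\<le>n. U \<inter> rat_poles (coeff m i) = {}) \<and>
      (\<forall>z\<in>U. (\<Sum>i\<le>n. rat_eval (coeff m i) z * \<omega> z ^ i) = 0))"

text \<open>The domain \<open>U\<close> is existentially quantified because solutions and algebraic functions
  are multivalued on the whole plane.\<close>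

definition has_type1_solution :: "ratfun \<Rightarrow> bool"
  where "has_type1_solution R \<longleftrightarrow>
    (\<exists>U \<omega> \<eta>. domain_in_plane U \<and> solves_on R U \<eta> \<and> exp_integral_on U \<omega> \<eta> \<and> rational_on U \<omega>)"

definition has_type2_solution :: "ratfun \<Rightarrow> bool"
  where "has_type2_solution R \<longleftrightarrow> \<not> has_type1_solution R \<and>
    (\<exists>U \<omega> \<eta>. domain_in_plane U \<and> solves_on R U \<eta> \<and> exp_integral_on U \<omega> \<eta> \<and>
      algebraic_degree_on 2 U \<omega>)"

section \<open>The equation of the Hess--Sretensky case\<close>

definition P3 :: "real \<Rightarrow> real \<Rightarrow> real \<Rightarrow> real \<Rightarrow> real \<Rightarrow> complex poly"
  where "P3 A B h p1 d1 = map_poly complex_of_real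
    [: 2 * (B * h - p1), 0, B - 2 * A, 2 * d1 :]"

definition Q3 :: "real \<Rightarrow> real \<Rightarrow> real \<Rightarrow> real \<Rightarrow> real \<Rightarrow> complex poly"
  where "Q3 A B h p1 d1 = monom (complex_of_real (4 * d1)) 3 - P3 A B h p1 d1"

definition P6 :: "real \<Rightarrow> real \<Rightarrow> real \<Rightarrow> complex poly"
  where "P6 B h p1 = map_poly complex_of_real
    [: 4 * (B * h - p1)\<^sup>2, 0, 4 * (h\<^sup>2 - 1 - B * (B * h - p1)), 0, B\<^sup>2 - 4 * h, 0, 1 :]"

definition P9 :: "real \<Rightarrow> real \<Rightarrow> real \<Rightarrow> real \<Rightarrow> real \<Rightarrow> complex poly"
  where "P9 A B h p1 d1 =
    (P3 A B h p1 d1 - [:0, 1:] * pderiv (P3 A B h p1 d1)) * P6 B h p1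
    + smult (1 / 2) ([:0, 1:] * P3 A B h p1 d1 * pderiv (P6 B h p1))"

definition coeff_a :: "real \<Rightarrow> real \<Rightarrow> real \<Rightarrow> real \<Rightarrow> real \<Rightarrow> ratfun"
  where "coeff_a A B h p1 d1 =
    Fraction_Field.Fract (P9 A B h p1 d1) ([:0, 1:] * P6 B h p1 * P3 A B h p1 d1)"

definition coeff_b :: "real \<Rightarrow> real \<Rightarrow> real \<Rightarrow> real \<Rightarrow> real \<Rightarrow> ratfun"
  where "coeff_b A B h p1 d1 =
    Fraction_Field.Fract (P3 A B h p1 d1 * Q3 A B h p1 d1) (4 * [:0, 1:] ^ 2 * P6 B h p1)"

text \<open>The equation \<open>u'' + a u' + b u = 0\<close> becomes \<open>y'' = R y\<close> under
  \<open>y = u exp (1/2 \<integral>a dx)\<close>.\<close>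

definition hess_R :: "real \<Rightarrow> real \<Rightarrow> real \<Rightarrow> real \<Rightarrow> real \<Rightarrow> ratfun"
  where "hess_R A B h p1 d1 =
    (let a = coeff_a A B h p1 d1; b = coeff_b A B h p1 d1
     in 1 / 2 * rat_deriv a + 1 / 4 * a\<^sup>2 - b)"

end

theory Submission
  imports Defs "HOL-Computational_Algebra.Fundamental_Theorem_Algebra"
begin

text \<open>If \<open>\<phi>\<close> and \<open>D\<close> are the trace and the discriminant of the minimal polynomial of \<open>\<omega>\<close>, then the
  absence of a type 1 solution forces \<open>D' = - 2 \<phi> D\<close> and \<open>D = 4 R - \<phi>\<^sup>2 - 2 \<phi>'\<close>. Writing
  \<open>s = - P\<^sub>3\<^sup>2 / (D P\<^sub>6)\<close> and \<open>\<sigma> = s'/s - 2/x\<close> turns this into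
  \<open>4 \<sigma>' + \<sigma>\<^sup>2 + 4 a \<sigma> + 16 b = 4 P\<^sub>3\<^sup>2 / (s P\<^sub>6)\<close>.
  Comparing the double poles at a hypothetical pole of \<open>s\<close> shows that \<open>s\<close> is a polynomial, and the
  behaviour at infinity, where \<open>d\<^sub>1\<close> is real and nonzero, bounds its degree by 2. At a root of
  \<open>P\<^sub>3\<close> the function \<open>s\<close> cannot vanish, so \<open>a\<close> having a pole there forces \<open>\<sigma>\<close> to vanish. Hence
  \<open>x s' - 2 s\<close>, of degree at most 1, has three roots, so that \<open>s = \<kappa> x\<^sup>2\<close>. The equation then
  reads \<open>\<kappa> Q\<^sub>3 = P\<^sub>3\<close>.\<close>

section \<open>Evaluation and differentiation of rational functions\<close>

lemma to_fract_numeral [simp]: "to_fract (numeral n) = numeral n"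
  using of_nat_fract [of "numeral n"] by (simp add: to_fract_def)

lemma fract_numeral_neq_0 [simp]: "(numeral n :: ratfun) \<noteq> 0"
  by (metis to_fract_numeral to_fract_eq_0_iff zero_neq_numeral)

text \<open>At a pole \<open>rat_eval\<close> returns 0 through division by zero, so it is additive
  and multiplicative only away from poles. Keeping the absence of a pole together with the value
  gives rules that compose without side conditions, except for a nonzero divisor.\<close>

definition has_rat_value :: "ratfun \<Rightarrow> complex \<Rightarrow> complex \<Rightarrow> bool"
  where "has_rat_value r z c \<longleftrightarrow> z \<notin> rat_poles r \<and> rat_eval r z = c"

lemma has_rat_value_rat_eval: "z \<notin> rat_poles r \<Longrightarrow> has_rat_value r z (rat_eval r z)"
  by (simp add: has_rat_value_def)

lemma has_rat_value_unique: "has_rat_value r z c \<Longrightarrow> has_rat_value r z d \<Longrightarrow> c = d"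
  by (simp add: has_rat_value_def)

text \<open>The fraction need not be in lowest terms. If \<open>a / b\<close> is its reduced form,
  then \<open>a * q = p * b\<close>, so a zero of \<open>b\<close> at \<open>z\<close> would also be
  a zero of \<open>a\<close>, against coprimality.\<close>

lemma has_rat_value_Fract:
  assumes "poly q z \<noteq> 0"
  shows "has_rat_value (Fraction_Field.Fract p q) z (poly p z / poly q z)"
proof -
  define a where "a = fst (quot_of_fract (Fraction_Field.Fract p q))"
  define b where "b = snd (quot_of_fract (Fraction_Field.Fract p q))"
  have b0: "b \<noteq> 0" and cop: "coprime a b" and q0: "q \<noteq> 0"
    using assms by (auto simp: a_def b_def coprime_quot_of_fract)
  have "Fraction_Field.Fract a b = Fraction_Field.Fract p q"
    by (simp add: a_def b_def)
  then have "a * q = p * b" using b0 q0 by (simp add: eq_fract)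
  then have e: "poly a z * poly q z = poly p z * poly b z"
    by (metis poly_mult)
  have "poly b z \<noteq> 0"
  proof
    assume b: "poly b z = 0"
    then have "poly a z = 0" using e assms by simp
    with b cop show False
      by (metis coprime_poly_0)
  qed
  with e assms show ?thesis
    unfolding has_rat_value_def rat_poles_def rat_eval_def a_def [symmetric] b_def [symmetric]
    by (simp add: field_simps)
qed

lemma has_rat_value_cases:
  assumes "has_rat_value r z c"
  obtains p q where "r = Fraction_Field.Fract p q" "q \<noteq> 0" "poly q z \<noteq> 0" "c = poly p z / poly q z"
proof
  show "r = Fraction_Field.Fract (fst (quot_of_fract r)) (snd (quot_of_fract r))" by simp
qed (use assms in \<open>auto simp: has_rat_value_def rat_poles_def rat_eval_def\<close>)

lemma has_rat_value_to_fract: "has_rat_value (to_fract p) z (poly p z)"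
  using has_rat_value_Fract [of 1 z p] by (simp add: to_fract_def)

lemma has_rat_value_add:
  assumes "has_rat_value r z c" "has_rat_value s z d"
  shows "has_rat_value (r + s) z (c + d)"
proof -
  obtain p q where 1: "r = Fraction_Field.Fract p q" "q \<noteq> 0" "poly q z \<noteq> 0" "c = poly p z / poly q z"
    by (rule has_rat_value_cases [OF assms(1)])
  obtain p' q' where 2: "s = Fraction_Field.Fract p' q'" "q' \<noteq> 0" "poly q' z \<noteq> 0" "d = poly p' z / poly q' z"
    by (rule has_rat_value_cases [OF assms(2)])
  show ?thesis
    using has_rat_value_Fract [of "q * q'" z "p * q' + p' * q"] 1 2 by (simp add: add_frac_eq)
qed

lemma has_rat_value_mult:
  assumes "has_rat_value r z c" "has_rat_value s z d"
  shows "has_rat_value (r * s) z (c * d)"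
proof -
  obtain p q where 1: "r = Fraction_Field.Fract p q" "q \<noteq> 0" "poly q z \<noteq> 0" "c = poly p z / poly q z"
    by (rule has_rat_value_cases [OF assms(1)])
  obtain p' q' where 2: "s = Fraction_Field.Fract p' q'" "q' \<noteq> 0" "poly q' z \<noteq> 0" "d = poly p' z / poly q' z"
    by (rule has_rat_value_cases [OF assms(2)])
  show ?thesis
    using has_rat_value_Fract [of "q * q'" z "p * p'"] 1 2 by simp
qed

lemma has_rat_value_inverse:
  assumes "has_rat_value r z c" "c \<noteq> 0"
  shows "has_rat_value (inverse r) z (inverse c)"
proof -
  obtain p q where 1: "r = Fraction_Field.Fract p q" "q \<noteq> 0" "poly q z \<noteq> 0" "c = poly p z / poly q z"
    by (rule has_rat_value_cases [OF assms(1)])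
  show ?thesis
    using has_rat_value_Fract [of p z q] 1 assms(2) by simp
qed

lemma has_rat_value_divide:
  "has_rat_value r z c \<Longrightarrow> has_rat_value s z d \<Longrightarrow> d \<noteq> 0 \<Longrightarrow> has_rat_value (r / s) z (c / d)"
  unfolding divide_inverse by (intro has_rat_value_mult has_rat_value_inverse)

lemma has_rat_value_numeral: "has_rat_value (numeral n) z (numeral n)"
  using has_rat_value_to_fract [of "numeral n" z] by simp

lemma has_rat_value_0: "has_rat_value 0 z 0"
  using has_rat_value_to_fract [of 0 z] by simp

lemma has_rat_value_1: "has_rat_value 1 z 1"
  using has_rat_value_to_fract [of 1 z] by simp

lemma has_rat_value_uminus: "has_rat_value r z c \<Longrightarrow> has_rat_value (- r) z (- c)"
  using has_rat_value_mult [OF has_rat_value_to_fract [of "-1" z], of r c] by simp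

lemma has_rat_value_diff:
  "has_rat_value r z c \<Longrightarrow> has_rat_value s z d \<Longrightarrow> has_rat_value (r - s) z (c - d)"
  using has_rat_value_add [OF _ has_rat_value_uminus] by fastforce

lemma has_rat_value_power: "has_rat_value r z c \<Longrightarrow> has_rat_value (r ^ n) z (c ^ n)"
  by (induction n) (auto intro: has_rat_value_mult has_rat_value_1)

lemmas has_rat_value_intros =
  has_rat_value_add has_rat_value_mult has_rat_value_diff has_rat_value_uminus has_rat_value_power
  has_rat_value_to_fract has_rat_value_numeral has_rat_value_0 has_rat_value_1

section \<open>The derivation of the field of rational functions, and its agreement with the complex
  derivative\<close>

lemma rat_deriv_to_fract [simp]: "rat_deriv (to_fract p) = to_fract (pderiv p)"
  using rat_deriv_Fract [of 1 p] by (simp add: to_fract_def)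

lemma rat_deriv_frac:
  "q \<noteq> 0 \<Longrightarrow> rat_deriv (to_fract p / to_fract q) =
    (to_fract (pderiv p) * to_fract q - to_fract p * to_fract (pderiv q)) / (to_fract q)\<^sup>2"
  using rat_deriv_Fract [of q p] by (simp add: Fract_conv_to_fract power2_eq_square)

lemma ratfun_cases:
  fixes r :: ratfun
  obtains p q where "r = to_fract p / to_fract q" "q \<noteq> 0" "coprime p q"
proof
  show "r = to_fract (fst (quot_of_fract r)) / to_fract (snd (quot_of_fract r))"
    by (simp flip: Fract_conv_to_fract)
qed (simp_all add: coprime_quot_of_fract)

lemma rat_deriv_mult: "rat_deriv (r * s) = rat_deriv r * s + r * rat_deriv s"
proof -
  obtain p q where 1: "r = to_fract p / to_fract q" "q \<noteq> 0" by (rule ratfun_cases)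
  obtain p' q' where 2: "s = to_fract p' / to_fract q'" "q' \<noteq> 0" by (rule ratfun_cases)
  have "r * s = to_fract (p * p') / to_fract (q * q')" by (simp add: 1 2)
  then have "rat_deriv (r * s) = (to_fract (pderiv (p * p')) * to_fract (q * q')
      - to_fract (p * p') * to_fract (pderiv (q * q'))) / (to_fract (q * q'))\<^sup>2"
    using 1 2 by (metis rat_deriv_frac no_zero_divisors)
  also have "\<dots> = rat_deriv r * s + r * rat_deriv s"
    using 1(2) 2(2) unfolding 1 2 by (simp add: rat_deriv_frac pderiv_mult divide_simps power2_eq_square) (simp add: algebra_simps)
  finally show ?thesis .
qed

lemma rat_deriv_add: "rat_deriv (r + s) = rat_deriv r + rat_deriv s"
proof -
  obtain p q where 1: "r = to_fract p / to_fract q" "q \<noteq> 0" by (rule ratfun_cases)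
  obtain p' q' where 2: "s = to_fract p' / to_fract q'" "q' \<noteq> 0" by (rule ratfun_cases)
  have "r + s = to_fract (p * q' + p' * q) / to_fract (q * q')"
    using 1(2) 2(2) by (simp add: 1 2 add_frac_eq)
  then have "rat_deriv (r + s) = (to_fract (pderiv (p * q' + p' * q)) * to_fract (q * q')
      - to_fract (p * q' + p' * q) * to_fract (pderiv (q * q'))) / (to_fract (q * q'))\<^sup>2"
    using 1 2 by (metis rat_deriv_frac no_zero_divisors)
  also have "\<dots> = rat_deriv r + rat_deriv s"
    using 1(2) 2(2) unfolding 1 2
    by (simp add: rat_deriv_frac pderiv_mult pderiv_add divide_simps power2_eq_square) (simp add: algebra_simps)
  finally show ?thesis .
qed

lemma rat_deriv_1 [simp]: "rat_deriv 1 = 0"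
  using rat_deriv_to_fract [of 1] by simp

lemma rat_deriv_0 [simp]: "rat_deriv 0 = 0"
  using rat_deriv_to_fract [of 0] by simp

lemma rat_deriv_numeral [simp]: "rat_deriv (numeral n) = 0"
proof (induction n)
  case (Bit0 n)
  then show ?case by (simp only: numeral.simps rat_deriv_add) simp
next
  case (Bit1 n)
  then show ?case by (simp only: numeral.simps rat_deriv_add rat_deriv_1) simp
qed simp

lemma rat_deriv_uminus: "rat_deriv (- r) = - rat_deriv r"
  using rat_deriv_add [of r "- r"] by (simp add: add_eq_0_iff)

lemma rat_deriv_diff: "rat_deriv (r - s) = rat_deriv r - rat_deriv s"
  using rat_deriv_add [of r "- s"] by (simp add: rat_deriv_uminus)

lemma rat_deriv_divide:
  assumes "s \<noteq> 0"
  shows "rat_deriv (r / s) = (rat_deriv r * s - r * rat_deriv s) / s\<^sup>2"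
proof -
  have "rat_deriv r = rat_deriv (r / s) * s + r / s * rat_deriv s"
    using assms rat_deriv_mult [of "r / s" s] by simp
  then show ?thesis using assms by (simp add: field_simps power2_eq_square)
qed

lemma has_rat_value_deriv:
  assumes "z \<notin> rat_poles r"
  shows "z \<notin> rat_poles (rat_deriv r)"
    and "(rat_eval r has_field_derivative rat_eval (rat_deriv r) z) (at z)"
proof -
  define p where "p = fst (quot_of_fract r)"
  define q where "q = snd (quot_of_fract r)"
  have q: "poly q z \<noteq> 0" "q \<noteq> 0" using assms by (auto simp: q_def rat_poles_def)
  have r: "r = Fraction_Field.Fract p q" by (simp add: p_def q_def)
  have "has_rat_value (rat_deriv r) z (poly (pderiv p * q - p * pderiv q) z / poly (q\<^sup>2) z)"
    unfolding r rat_deriv_Fract [OF q(2)] by (rule has_rat_value_Fract) (use q in simp)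
  then have v: "z \<notin> rat_poles (rat_deriv r)"
    "rat_eval (rat_deriv r) z = poly (pderiv p * q - p * pderiv q) z / poly (q\<^sup>2) z"
    by (auto simp: has_rat_value_def)
  show "z \<notin> rat_poles (rat_deriv r)" by fact
  have "rat_eval r = (\<lambda>w. poly p w / poly q w)" by (auto simp: rat_eval_def p_def q_def)
  moreover have "((\<lambda>w. poly p w / poly q w) has_field_derivative rat_eval (rat_deriv r) z) (at z)"
    unfolding v(2) using q
    by (auto intro!: derivative_eq_intros simp: power2_eq_square)
  ultimately show "(rat_eval r has_field_derivative rat_eval (rat_deriv r) z) (at z)" by simp
qed

section \<open>Finiteness of zeros, the identity principle and the shrinking of domains\<close>

lemma finite_rat_zeros:
  assumes "r \<noteq> 0"
  shows "finite {z. has_rat_value r z 0}"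
proof (rule finite_subset)
  show "{z. has_rat_value r z 0} \<subseteq> {z. poly (fst (quot_of_fract r)) z = 0}"
    by (auto simp: has_rat_value_def rat_poles_def rat_eval_def)
  show "finite {z. poly (fst (quot_of_fract r)) z = 0}"
    using assms by (intro poly_roots_finite) simp
qed

lemma rat_eq_0I:
  assumes "open S" "S \<noteq> {}" "\<And>z. z \<in> S \<Longrightarrow> has_rat_value r z 0"
  shows "r = 0"
proof (rule ccontr)
  assume "r \<noteq> 0"
  then have "finite S"
    by (rule finite_subset [OF _ finite_rat_zeros, rotated]) (use assms(3) in auto)
  then show False
    using assms(1,2) finite_imp_not_open by blast
qed

lemma ball_avoiding_finite:
  assumes "domain_in_plane U" "finite S"
  obtains B where "domain_in_plane B" "B \<subseteq> U" "B \<inter> S = {}"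
proof -
  have "open (U - S)" using assms by (auto simp: domain_in_plane_def finite_imp_closed)
  moreover have "U - S \<noteq> {}"
    using assms finite_imp_not_open finite_subset by (auto simp: domain_in_plane_def)
  ultimately obtain z e where "e > 0" "ball z e \<subseteq> U - S"
    by (meson ex_in_conv open_contains_ball)
  then show ?thesis
    by (intro that [of "ball z e"]) (auto simp: domain_in_plane_def)
qed

text \<open>The residue of a logarithmic derivative is the order of vanishing: if
  \<open>f = t ^ k * g\<close> with \<open>t = x - z\<close> and \<open>g\<close> nonzero at
  \<open>z\<close>, then \<open>t * f' / f = k + t * g' / g\<close>.\<close>

lemma rat_log_deriv_value:
  assumes "f \<noteq> 0"
  obtains e where "has_rat_value e z (of_nat (order z f))"
    "e = to_fract [:-z, 1:] * (to_fract (pderiv f) / to_fract f)"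
proof -
  obtain g where f: "f = [:-z, 1:] ^ order z f * g" and g: "\<not> [:-z, 1:] dvd g"
    using order_decomp [OF assms] by blast
  define k where "k = order z f"
  define t where "t = [:-z, 1:]"
  have gz: "poly g z \<noteq> 0" using g by (simp add: poly_eq_0_iff_dvd)
  then have g0: "g \<noteq> 0" and t0: "t \<noteq> 0" by (auto simp: t_def)
  have "f = t ^ k * g" using f by (simp add: t_def k_def)
  \<comment> \<open>The extra factor \<open>t\<close> avoids the exponent \<open>k - 1\<close>, so
    that \<open>k = 0\<close> is covered as well.\<close>
  moreover have "t * pderiv (t ^ k) = of_nat k * t ^ k"
    by (cases k) (simp_all add: pderiv_power_Suc pderiv_pCons t_def of_nat_poly algebra_simps del: power_Suc,
        simp add: algebra_simps)
  ultimately have "t * pderiv f = t ^ k * (of_nat k * g + t * pderiv g)"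
    by (simp add: pderiv_mult algebra_simps)
  then have "t * pderiv f * g = f * (of_nat k * g + t * pderiv g)"
    using \<open>f = t ^ k * g\<close> by (simp add: algebra_simps)
  then have "to_fract t * to_fract (pderiv f) * to_fract g
      = to_fract f * to_fract (of_nat k * g + t * pderiv g)"
    by (metis to_fract_mult)
  then have "to_fract t * (to_fract (pderiv f) / to_fract f)
      = to_fract (of_nat k * g + t * pderiv g) / to_fract g"
    using assms g0 by (simp add: divide_simps)
  moreover have "has_rat_value (to_fract (of_nat k * g + t * pderiv g) / to_fract g) z
      (poly (of_nat k * g + t * pderiv g) z / poly g z)"
    using gz by (intro has_rat_value_divide has_rat_value_to_fract)
  ultimately show ?thesis
    using gz by (intro that) (simp_all add: t_def k_def of_nat_poly)
qed

section \<open>The discriminant of a type 2 solution\<close>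

lemma solves_on_subset: "solves_on R U y \<Longrightarrow> V \<subseteq> U \<Longrightarrow> solves_on R V y"
  unfolding solves_on_def using holomorphic_on_subset by blast

lemma exp_integral_on_subset: "exp_integral_on U \<omega> \<eta> \<Longrightarrow> V \<subseteq> U \<Longrightarrow> exp_integral_on V \<omega> \<eta>"
  unfolding exp_integral_on_def by blast

text \<open>Here \<omega> is the logarithmic derivative of \<eta>, so \<eta>'' = (\<omega>' +
  \<omega> * \<omega>) \<eta>, and \<eta> cancels because an exponential never vanishes. The
  function \<omega> is holomorphic as the derivative of the holomorphic function
  \<open>W\<close>.\<close>

lemma log_derivative_riccati:
  assumes U: "open U" and sol: "solves_on R U \<eta>" and int: "exp_integral_on U \<omega> \<eta>" and z: "z \<in> U"
  shows "(\<omega> has_field_derivative (rat_eval R z - (\<omega> z)\<^sup>2)) (at z)"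
proof -
  obtain W where W: "\<And>z. z \<in> U \<Longrightarrow> (W has_field_derivative \<omega> z) (at z)"
    and \<eta>: "\<And>z. z \<in> U \<Longrightarrow> \<eta> z = exp (W z)"
    using int unfolding exp_integral_on_def by metis
  have "W holomorphic_on U"
    using U W by (metis holomorphic_on_open)
  then have "deriv W holomorphic_on U"
    using U by (rule holomorphic_deriv)
  then have "\<omega> holomorphic_on U"
    by (rule holomorphic_transform) (simp add: W DERIV_imp_deriv)
  then have d\<omega>: "(\<omega> has_field_derivative deriv \<omega> w) (at w)" if "w \<in> U" for w
    using U that holomorphic_derivI by blast
  have d\<eta>: "(\<eta> has_field_derivative (\<omega> w * exp (W w))) (at w)" if "w \<in> U" for w
  proof (rule has_field_derivative_transform_within_open [OF _ U that])
    show "((\<lambda>w. exp (W w)) has_field_derivative (\<omega> w * exp (W w))) (at w)"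
      using W [OF that] by (auto intro!: derivative_eq_intros)
  qed (simp add: \<eta>)
  have "(deriv \<eta> has_field_derivative ((deriv \<omega> z + (\<omega> z)\<^sup>2) * \<eta> z)) (at z)"
  proof (rule has_field_derivative_transform_within_open [OF _ U z])
    show "((\<lambda>w. \<omega> w * exp (W w)) has_field_derivative ((deriv \<omega> z + (\<omega> z)\<^sup>2) * \<eta> z)) (at z)"
      using W [OF z] d\<omega> [OF z]
      by (auto intro!: derivative_eq_intros simp: \<eta> [OF z] algebra_simps power2_eq_square)
    show "\<omega> w * exp (W w) = deriv \<eta> w" if "w \<in> U" for w
      using d\<eta> [OF that] by (simp add: DERIV_imp_deriv)
  qed
  then have "deriv (deriv \<eta>) z = (deriv \<omega> z + (\<omega> z)\<^sup>2) * \<eta> z"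
    by (rule DERIV_imp_deriv)
  then have "(deriv \<omega> z + (\<omega> z)\<^sup>2) * \<eta> z = rat_eval R z * \<eta> z"
    using sol z unfolding solves_on_def by metis
  then have "deriv \<omega> z = rat_eval R z - (\<omega> z)\<^sup>2"
    by (simp add: \<eta> [OF z] eq_diff_eq)
  with d\<omega> [OF z] show ?thesis by simp
qed

text \<open>On a smaller domain that avoids the zeros of \<open>r\<close>, the relation solves to
  \<omega> = - s / r. Used contrapositively: without a type 1 solution, the coefficient of \<omega>
  in every linear relation over the rational functions is zero.\<close>

lemma type1_of_linear_relation:
  assumes U: "domain_in_plane U" and sol: "solves_on R U \<eta>" and int: "exp_integral_on U \<omega> \<eta>"
    and rel: "\<And>z. z \<in> U \<Longrightarrow> \<exists>c d. has_rat_value r z c \<and> has_rat_value s z d \<and> c * \<omega> z + d = 0"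
    and "r \<noteq> 0"
  shows "has_type1_solution R"
proof -
  obtain B where B: "domain_in_plane B" "B \<subseteq> U" "B \<inter> {z. has_rat_value r z 0} = {}"
    using ball_avoiding_finite [OF U finite_rat_zeros [OF \<open>r \<noteq> 0\<close>]] by blast
  have "has_rat_value (- s / r) z (\<omega> z)" if z: "z \<in> B" for z
  proof -
    obtain c d where cd: "has_rat_value r z c" "has_rat_value s z d" "c * \<omega> z + d = 0"
      using rel B z by blast
    moreover have "c \<noteq> 0" using cd B z by blast
    moreover from this have "\<omega> z = - d / c" using cd(3) by (simp add: field_simps add_eq_0_iff)
    ultimately show ?thesis
      by (metis has_rat_value_divide has_rat_value_uminus)
  qed
  then have "rational_on B \<omega>"
    unfolding rational_on_def has_rat_value_def by (metis disjoint_iff)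
  then show ?thesis
    unfolding has_type1_solution_def
    using B solves_on_subset [OF sol] exp_integral_on_subset [OF int] by blast
qed

text \<open>Here \<open>\<phi>\<close> is the sum of the two conjugates of \<open>\<omega>\<close> and \<open>D\<close> is the discriminant of
  its minimal polynomial.\<close>

lemma type2_discriminant:
  assumes "has_type2_solution R"
  obtains D \<phi> where "D \<noteq> 0" "rat_deriv D = - 2 * \<phi> * D" "D = 4 * R - \<phi>\<^sup>2 - 2 * rat_deriv \<phi>"
proof -
  have no1: "\<not> has_type1_solution R"
    using assms by (simp add: has_type2_solution_def)
  obtain U \<omega> \<eta> where U: "domain_in_plane U" and sol: "solves_on R U \<eta>"
    and int: "exp_integral_on U \<omega> \<eta>" and alg: "algebraic_degree_on 2 U \<omega>"
    using assms unfolding has_type2_solution_def by blast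
  obtain m :: "ratfun poly" where m: "degree m = 2"
    and mp: "\<And>i. i \<le> 2 \<Longrightarrow> U \<inter> rat_poles (coeff m i) = {}"
    and m0: "\<And>z. z \<in> U \<Longrightarrow> (\<Sum>i\<le>2. rat_eval (coeff m i) z * \<omega> z ^ i) = 0"
    using alg unfolding algebraic_degree_on_def by blast
  define l where "l = coeff m 2"
  define \<phi> where "\<phi> = - coeff m 1 / l"
  define \<psi> where "\<psi> = coeff m 0 / l"
  have l0: "l \<noteq> 0" using m unfolding l_def by (metis leading_coeff_0_iff degree_0 zero_neq_numeral)
  \<comment> \<open>Away from the zeros of the leading coefficient the quadratic equation can be
    made monic: \<omega> * \<omega> - \<phi> \<omega> + \<psi> = 0.\<close>
  obtain B where B: "domain_in_plane B" "B \<subseteq> U" "B \<inter> {z. has_rat_value l z 0} = {}"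
    using ball_avoiding_finite [OF U finite_rat_zeros [OF l0]] by blast
  have oB: "open B" "B \<noteq> {}" using B(1) by (auto simp: domain_in_plane_def)
  have solB: "solves_on R B \<eta>" and intB: "exp_integral_on B \<omega> \<eta>"
    using solves_on_subset [OF sol B(2)] exp_integral_on_subset [OF int B(2)] by auto
  have cval: "has_rat_value (coeff m i) z (rat_eval (coeff m i) z)" if "z \<in> B" "i \<le> 2" for z i
    using mp [OF that(2)] that B(2) by (intro has_rat_value_rat_eval) blast
  have val: "has_rat_value \<phi> z (rat_eval \<phi> z) \<and> has_rat_value \<psi> z (rat_eval \<psi> z)
    \<and> (\<omega> z)\<^sup>2 - rat_eval \<phi> z * \<omega> z + rat_eval \<psi> z = 0" if z: "z \<in> B" for z
  proof -
    define c where "c = (\<lambda>i. rat_eval (coeff m i) z)"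
    have c2: "c 2 \<noteq> 0"
      using B(3) z cval [OF z, of 2] by (auto simp: c_def l_def)
    have p: "has_rat_value \<phi> z (- c 1 / c 2)" and q: "has_rat_value \<psi> z (c 0 / c 2)"
      unfolding \<phi>_def \<psi>_def l_def using c2 cval [OF z]
      by (auto simp: c_def intro!: has_rat_value_divide has_rat_value_uminus)
    have "c 0 + c 1 * \<omega> z + c 2 * (\<omega> z)\<^sup>2 = 0"
      using m0 [of z] z B(2) by (auto simp: c_def numeral_2_eq_2)
    moreover have "(\<omega> z)\<^sup>2 - (- c 1 / c 2) * \<omega> z + c 0 / c 2
        = (c 0 + c 1 * \<omega> z + c 2 * (\<omega> z)\<^sup>2) / c 2"
      using c2 by (simp add: add_divide_distrib)
    ultimately have "(\<omega> z)\<^sup>2 - (- c 1 / c 2) * \<omega> z + c 0 / c 2 = 0"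
      by simp
    with p q show ?thesis by (auto simp: has_rat_value_def)
  qed
  \<comment> \<open>Differentiating the monic quadratic, replacing \<omega>' by the Riccati equation
    and reducing modulo the quadratic leaves the linear relation
    \<open>X * \<omega> + Y = 0\<close>.\<close>
  define X where "X = 2 * R + 2 * \<psi> - \<phi>\<^sup>2 - rat_deriv \<phi>"
  define Y where "Y = \<phi> * (\<psi> - R) + rat_deriv \<psi>"
  have rel: "\<exists>c d. has_rat_value X z c \<and> has_rat_value Y z d \<and> c * \<omega> z + d = 0" if z: "z \<in> B" for z
  proof -
    define w f g r where "w = \<omega> z" "f = rat_eval \<phi> z" "g = rat_eval \<psi> z" "r = rat_eval R z"
    define f' g' where "f' = rat_eval (rat_deriv \<phi>) z" "g' = rat_eval (rat_deriv \<psi>) z"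
    have poles: "z \<notin> rat_poles \<phi>" "z \<notin> rat_poles \<psi>" "z \<notin> rat_poles R"
      using val [OF z] solB z by (auto simp: has_rat_value_def solves_on_def)
    have v: "has_rat_value \<phi> z f" "has_rat_value \<psi> z g" "has_rat_value R z r"
      "has_rat_value (rat_deriv \<phi>) z f'" "has_rat_value (rat_deriv \<psi>) z g'"
      using poles has_rat_value_deriv(1) has_rat_value_rat_eval
      by (auto simp: w_f_g_r_def f'_g'_def)
    have "((\<lambda>z. (\<omega> z)\<^sup>2 - rat_eval \<phi> z * \<omega> z + rat_eval \<psi> z) has_field_derivative
        (2 * w * (r - w\<^sup>2) - (f' * w + f * (r - w\<^sup>2)) + g')) (at z)"
      using log_derivative_riccati [OF oB(1) solB intB z]
        has_rat_value_deriv(2) [OF poles(1)] has_rat_value_deriv(2) [OF poles(2)]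
      by (auto intro!: derivative_eq_intros simp: w_f_g_r_def f'_g'_def)
    moreover have "((\<lambda>z. (\<omega> z)\<^sup>2 - rat_eval \<phi> z * \<omega> z + rat_eval \<psi> z) has_field_derivative 0) (at z)"
      by (rule has_field_derivative_transform_within_open [OF DERIV_const [of 0] oB(1) z])
        (use val in auto)
    ultimately have 1: "2 * w * (r - w\<^sup>2) - (f' * w + f * (r - w\<^sup>2)) + g' = 0"
      by (rule DERIV_unique)
    have 2: "w\<^sup>2 = f * w - g" using val [OF z] by (simp add: w_f_g_r_def algebra_simps)
    have "(2 * r + 2 * g - f\<^sup>2 - f') * w + (f * (g - r) + g') = 0"
      using 1 2 by algebra
    moreover have "has_rat_value X z (2 * r + 2 * g - f\<^sup>2 - f')" "has_rat_value Y z (f * (g - r) + g')"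
      unfolding X_def Y_def by (intro has_rat_value_intros v)+
    ultimately show ?thesis unfolding w_f_g_r_def(1) by blast
  qed
  have X: "X = 0"
    using type1_of_linear_relation [OF B(1) solB intB rel] no1 by blast
  have Y: "Y = 0"
  proof (rule rat_eq_0I [OF oB])
    fix z assume "z \<in> B"
    from rel [OF this] show "has_rat_value Y z 0"
      unfolding X using has_rat_value_unique [OF has_rat_value_0] by force
  qed
  define D where "D = \<phi>\<^sup>2 - 4 * \<psi>"
  have D0: "D \<noteq> 0"
  proof
    \<comment> \<open>With a vanishing discriminant the quadratic is a perfect square, so 2 \<omega>
      - \<phi> = 0 would be a linear relation with the nonzero leading coefficient 2.\<close>
    assume D: "D = 0"
    have "\<exists>c d. has_rat_value 2 z c \<and> has_rat_value (- \<phi>) z d \<and> c * \<omega> z + d = 0" if z: "z \<in> B" for z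
    proof -
      have "has_rat_value D z ((rat_eval \<phi> z)\<^sup>2 - 4 * rat_eval \<psi> z)"
        unfolding D_def using val [OF z] by (intro has_rat_value_intros) auto
      then have "(rat_eval \<phi> z)\<^sup>2 - 4 * rat_eval \<psi> z = 0"
        unfolding D using has_rat_value_unique has_rat_value_0 by blast
      moreover have "(\<omega> z)\<^sup>2 - rat_eval \<phi> z * \<omega> z + rat_eval \<psi> z = 0" using val [OF z] by blast
      ultimately have "(2 * \<omega> z + - rat_eval \<phi> z)\<^sup>2 = 0" by algebra
      then have "2 * \<omega> z + - rat_eval \<phi> z = 0" by simp
      moreover have "has_rat_value (- \<phi>) z (- rat_eval \<phi> z)"
        using val [OF z] by (intro has_rat_value_uminus) blast
      ultimately show ?thesis using has_rat_value_numeral by blast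
    qed
    then show False
      using type1_of_linear_relation [OF B(1) solB intB] no1 fract_numeral_neq_0 by blast
  qed
  have \<psi>: "2 * \<psi> = \<phi>\<^sup>2 + rat_deriv \<phi> - 2 * R" using X unfolding X_def by algebra
  have d\<psi>: "rat_deriv \<psi> = \<phi> * (R - \<psi>)" using Y unfolding Y_def by algebra
  have dD: "rat_deriv D = 2 * \<phi> * rat_deriv \<phi> - 4 * rat_deriv \<psi>"
    by (simp add: D_def rat_deriv_diff rat_deriv_mult power2_eq_square)
  show ?thesis
  proof (rule that [OF D0])
    show "rat_deriv D = - 2 * \<phi> * D" using \<psi> d\<psi> dD D_def by algebra
    show "D = 4 * R - \<phi>\<^sup>2 - 2 * rat_deriv \<phi>" using \<psi> D_def by algebra
  qed
qed

section \<open>The equation for \<open>s\<close>\<close>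

text \<open>This compares the coefficients of \<open>1 / (x - z)^2\<close>: \<sigma>,
  \<open>a\<close> and \<open>c\<close> have leading terms \<open>n / (x - z)\<close>, \<alpha> / (x
  - z) and \<gamma> / (x - z)^2, while \<open>r\<close> has none of that order. The derivative of
  \<sigma> contributes \<open>- n\<close>.\<close>

lemma indicial_equation:
  assumes eq: "4 * rat_deriv \<sigma> + \<sigma>\<^sup>2 + 4 * a * \<sigma> + c = r"
    and \<sigma>: "has_rat_value (to_fract [:-z, 1:] * \<sigma>) z n"
    and a: "has_rat_value (to_fract [:-z, 1:] * a) z \<alpha>"
    and c: "has_rat_value ((to_fract [:-z, 1:])\<^sup>2 * c) z \<gamma>"
    and r: "has_rat_value ((to_fract [:-z, 1:])\<^sup>2 * r) z 0"
  shows "n\<^sup>2 - 4 * n + 4 * \<alpha> * n + \<gamma> = 0"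
proof -
  define t where "t = to_fract [:-z, 1:]"
  have "pderiv [:-z, 1:] = 1" by (simp add: pderiv_pCons one_pCons)
  then have t: "has_rat_value t z 0" "rat_deriv t = 1"
    using has_rat_value_to_fract [of "[:-z, 1:]" z] by (simp_all add: t_def)
  obtain d where d: "has_rat_value (rat_deriv (t * \<sigma>)) z d"
    using \<sigma> has_rat_value_deriv(1) has_rat_value_rat_eval unfolding has_rat_value_def t_def by blast
  \<comment> \<open>The identity t * t * \<sigma>' = t * (t * \<sigma>)' - t * \<sigma> leaves only
    functions regular at \<open>z\<close>; the unknown value \<open>d\<close> of (t * \<sigma>)' is
    multiplied by 0.\<close>
  have "t\<^sup>2 * r = 4 * (t * rat_deriv (t * \<sigma>) - t * \<sigma>) + (t * \<sigma>)\<^sup>2 + 4 * (t * a) * (t * \<sigma>) + t\<^sup>2 * c"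
    unfolding eq [symmetric] rat_deriv_mult t(2) by (simp add: algebra_simps power2_eq_square)
  moreover have "has_rat_value (4 * (t * rat_deriv (t * \<sigma>) - t * \<sigma>) + (t * \<sigma>)\<^sup>2
      + 4 * (t * a) * (t * \<sigma>) + t\<^sup>2 * c) z (4 * (0 * d - n) + n\<^sup>2 + 4 * \<alpha> * n + \<gamma>)"
    using \<sigma> a c d t unfolding t_def [symmetric] by (intro has_rat_value_intros)
  ultimately have "4 * (0 * d - n) + n\<^sup>2 + 4 * \<alpha> * n + \<gamma> = 0"
    using r unfolding t_def [symmetric] by (metis has_rat_value_unique)
  then show ?thesis by (simp add: algebra_simps)
qed

section \<open>Multiplicities and pole orders\<close>

lemma rat_value_divide_order_le:
  assumes "f \<noteq> 0" "order z f \<le> n"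
  obtains c where "has_rat_value (to_fract [:-z, 1:] ^ n / to_fract f) z c"
proof -
  obtain g where f: "f = [:-z, 1:] ^ order z f * g" and "\<not> [:-z, 1:] dvd g"
    using order_decomp [OF assms(1)] by blast
  define k where "k = order z f"
  have g: "poly g z \<noteq> 0" using \<open>\<not> _ dvd g\<close> by (simp add: poly_eq_0_iff_dvd)
  define t where "t = to_fract [:-z, 1:]"
  have hom: "to_fract (p ^ m) = to_fract p ^ m" for p :: "complex poly" and m
    by (induction m) simp_all
  have "to_fract f = t ^ k * to_fract g"
    using f unfolding k_def t_def by (metis hom to_fract_mult)
  moreover have "t ^ n = t ^ (n - k) * t ^ k" "t \<noteq> 0"
    using assms(2) by (simp_all add: k_def t_def flip: power_add)
  ultimately have "t ^ n / to_fract f = t ^ (n - k) / to_fract g"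
    by simp
  moreover have "has_rat_value (t ^ (n - k) / to_fract g) z (poly [:-z, 1:] z ^ (n - k) / poly g z)"
    unfolding t_def by (intro has_rat_value_divide has_rat_value_intros g)
  ultimately show ?thesis using that unfolding t_def by metis
qed

text \<open>Dropping one factor from a multiple root keeps the set of roots but lowers the degree,
  so there would be fewer than \<open>degree p\<close> distinct roots.\<close>

lemma order_le_1_of_card_roots:
  fixes p :: "complex poly"
  assumes "p \<noteq> 0" "card {z. poly p z = 0} = degree p"
  shows "order z p \<le> 1"
proof (rule ccontr)
  assume "\<not> order z p \<le> 1"
  then have "[:-z, 1:] ^ 2 dvd p"
    by (simp add: order_divides)
  then obtain g where p: "p = [:-z, 1:] ^ 2 * g" by (elim dvdE)
  have g: "g \<noteq> 0" using p assms by auto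
  then have tg: "[:-z, 1:] * g \<noteq> 0" by (metis mult_eq_0_iff pCons_eq_0_iff one_neq_zero)
  have "card {z. poly p z = 0} \<le> card {w. poly ([:-z, 1:] * g) w = 0}"
    unfolding p using tg by (intro card_mono poly_roots_finite) auto
  also have "\<dots> \<le> degree ([:-z, 1:] * g)"
    using tg by (rule card_poly_roots_bound)
  also have "\<dots> < degree p"
    using g by (simp add: p degree_mult_eq degree_power_eq del: mult_pCons_left mult_pCons_right)
  finally show False using assms by simp
qed

text \<open>The number \<open>n\<close> only bounds the degree and \<open>c\<close> may be 0. Unlike
  the leading coefficient, this behaves well under sums whose top terms cancel, which is what an
  expansion at infinity needs.\<close>

definition top_coeff :: "nat \<Rightarrow> complex poly \<Rightarrow> complex \<Rightarrow> bool"
  where "top_coeff n p c \<longleftrightarrow> degree p \<le> n \<and> coeff p n = c"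

lemma top_coeff_unique: "top_coeff n p c \<Longrightarrow> top_coeff n p d \<Longrightarrow> c = d"
  by (simp add: top_coeff_def)

lemma top_coeff_add: "top_coeff n p c \<Longrightarrow> top_coeff n q d \<Longrightarrow> top_coeff n (p + q) (c + d)"
  by (auto simp: top_coeff_def intro: degree_add_le)

lemma top_coeff_diff: "top_coeff n p c \<Longrightarrow> top_coeff n q d \<Longrightarrow> top_coeff n (p - q) (c - d)"
  by (auto simp: top_coeff_def intro: degree_diff_le)

lemma top_coeff_smult: "top_coeff n p c \<Longrightarrow> top_coeff n (smult k p) (k * c)"
  by (auto simp: top_coeff_def intro: order_trans [OF degree_smult_le])

lemma top_coeff_numeral_mult: "top_coeff n p c \<Longrightarrow> top_coeff n (numeral k * p) (numeral k * c)"
  using top_coeff_smult [of n p c "numeral k"] by (simp add: numeral_poly)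

lemma top_coeff_mult:
  assumes "top_coeff m p c" "top_coeff n q d"
  shows "top_coeff (m + n) (p * q) (c * d)"
proof -
  have "coeff (p * q) (m + n) = (\<Sum>i\<le>m + n. coeff p i * coeff q (m + n - i))"
    by (rule coeff_mult)
  also have "\<dots> = (\<Sum>i\<in>{m}. coeff p i * coeff q (m + n - i))"
  proof (rule sum.mono_neutral_right)
    show "\<forall>i\<in>{..m + n} - {m}. coeff p i * coeff q (m + n - i) = 0"
    proof
      fix i assume "i \<in> {..m + n} - {m}"
      then have "i > m \<or> m + n - i > n" by auto
      then show "coeff p i * coeff q (m + n - i) = 0"
        using assms by (auto simp: top_coeff_def intro: coeff_eq_0)
    qed
  qed auto
  finally show ?thesis
    using assms by (auto simp: top_coeff_def intro: order_trans [OF degree_mult_le])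
qed

text \<open>The operator \<open>x d/dx\<close> multiplies \<open>x^n\<close> by \<open>n\<close> and
  preserves the degree bound, so no shift of \<open>n\<close> has to be tracked.\<close>

lemma top_coeff_euler:
  assumes "top_coeff n p c"
  shows "top_coeff n ([:0, 1:] * pderiv p) (of_nat n * c)"
proof (cases n)
  case 0
  with assms show ?thesis
    by (auto simp: top_coeff_def pderiv_eq_0_iff elim!: degree_eq_zeroE)
next
  case (Suc k)
  have "degree (pCons 0 (pderiv p)) \<le> Suc (degree (pderiv p))"
    by (rule degree_pCons_le)
  with assms Suc show ?thesis
    by (auto simp: top_coeff_def coeff_pderiv degree_pderiv)
qed

text \<open>Take logarithmic derivatives in \<open>s * D * q = - p^2\<close> and use D' / D = - 2
  \<phi>.\<close>

lemma rational_log_deriv_eq: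
  fixes s D \<phi> p q :: ratfun
  assumes "D \<noteq> 0" "rat_deriv D = - 2 * \<phi> * D" "p \<noteq> 0" "q \<noteq> 0"
    and "s = - p\<^sup>2 / (D * q)"
  shows "rat_deriv s / s = 2 * rat_deriv p / p - rat_deriv q / q + 2 * \<phi>"
proof -
  have s: "s * (D * q) = - p\<^sup>2"
    using assms by simp
  have "rat_deriv (s * (D * q)) = rat_deriv (- p\<^sup>2)"
    by (simp only: s)
  then have "rat_deriv s * (D * q) + s * (- 2 * \<phi> * D * q + D * rat_deriv q) = - 2 * p * rat_deriv p"
    by (simp add: rat_deriv_uminus rat_deriv_mult power2_eq_square assms(2))
  with s have "D * (rat_deriv s * p * q) = D * (s * (2 * rat_deriv p * q - rat_deriv q * p + 2 * \<phi> * p * q))"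
    by algebra
  then have "rat_deriv s * p * q = s * (2 * rat_deriv p * q - rat_deriv q * p + 2 * \<phi> * p * q)"
    using assms(1) by simp
  moreover have "s \<noteq> 0" using assms by simp
  ultimately show ?thesis
    using assms(3,4) by (simp add: divide_simps mult.commute mult.left_commute)
qed

section \<open>Consequences of the nine distinct roots\<close>

locale hess_simple_roots =
  fixes A B h p1 d1 :: real
  assumes d1: "d1 \<noteq> 0"
    and card_roots: "card {z :: complex. poly (P3 A B h p1 d1 * P6 B h p1) z = 0} = 9"
begin

abbreviation "p3 \<equiv> P3 A B h p1 d1"
abbreviation "p6 \<equiv> P6 B h p1"
abbreviation "q3 \<equiv> Q3 A B h p1 d1"
abbreviation "p9 \<equiv> P9 A B h p1 d1"
abbreviation X :: "complex poly" where "X \<equiv> [:0, 1:]"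
abbreviation "a \<equiv> coeff_a A B h p1 d1"
abbreviation "b \<equiv> coeff_b A B h p1 d1"

lemma p3_eq: "p3 = [: of_real (2 * (B * h - p1)), 0, of_real (B - 2 * A), of_real (2 * d1) :]"
  using d1 by (simp add: P3_def map_poly_pCons)

lemma p6_eq: "p6 = [: of_real (4 * (B * h - p1)\<^sup>2), 0, of_real (4 * (h\<^sup>2 - 1 - B * (B * h - p1))), 0,
    of_real (B\<^sup>2 - 4 * h), 0, 1 :]"
  by (simp add: P6_def map_poly_pCons)

lemma q3_eq: "q3 = [: - of_real (2 * (B * h - p1)), 0, - of_real (B - 2 * A), of_real (2 * d1) :]"
  by (simp add: Q3_def p3_eq numeral_3_eq_3 monom_Suc monom_0)

lemma degree_p3: "degree p3 = 3" using d1 by (simp add: p3_eq)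
lemma degree_p6: "degree p6 = 6" by (simp add: p6_eq)
lemma p3_neq_0: "p3 \<noteq> 0" using degree_p3 by auto
lemma p6_neq_0: "p6 \<noteq> 0" using degree_p6 by auto

lemma order_p3_p6: "order z p3 + order z p6 \<le> 1"
proof -
  have "order z (p3 * p6) \<le> 1"
    using card_roots p3_neq_0 p6_neq_0
    by (intro order_le_1_of_card_roots) (simp_all add: degree_mult_eq degree_p3 degree_p6)
  then show ?thesis
    using p3_neq_0 p6_neq_0 by (simp add: order_mult)
qed

lemma p3_p6_no_common_root: "poly p3 z = 0 \<Longrightarrow> poly p6 z \<noteq> 0"
  using order_p3_p6 [of z] order_root [of p3 z] order_root [of p6 z] p3_neq_0 p6_neq_0 by linarith

text \<open>If \<open>p1 = B * h\<close>, both constant terms vanish and 0 is a common root. So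
  distinct roots exclude the first equation in the conclusion of the theorem, which thereby amounts
  to the absence of type 2 solutions. Within the proof the lemma separates \<open>x = 0\<close> from
  the roots of \<open>p3\<close> and \<open>p6\<close>.\<close>

lemma Bh_neq_p1: "B * h - p1 \<noteq> 0"
proof
  assume "B * h - p1 = 0"
  then have "poly p3 0 = 0" "poly p6 0 = 0"
    by (simp_all add: p3_eq p6_eq del: of_real_mult of_real_diff)
  then show False using p3_p6_no_common_root by blast
qed

lemma poly_0_neq_0: "poly p3 0 \<noteq> 0" "poly p6 0 \<noteq> 0"
  using Bh_neq_p1 by (simp_all add: p3_eq p6_eq del: of_real_mult of_real_diff)

lemma order_root_p3: "poly p3 z = 0 \<Longrightarrow> order z p3 = 1"
  using order_p3_p6 [of z] order_root [of p3 z] p3_neq_0 by linarith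

lemma card_roots_p3: "card {z. poly p3 z = 0} \<ge> 3"
proof -
  have "{z. poly (p3 * p6) z = 0} = {z. poly p3 z = 0} \<union> {z. poly p6 z = 0}" by auto
  then have "9 \<le> card {z. poly p3 z = 0} + card {z. poly p6 z = 0}"
    using card_roots card_Un_le by metis
  also have "card {z. poly p6 z = 0} \<le> 6"
    using card_poly_roots_bound [OF p6_neq_0] by (simp add: degree_p6)
  finally show ?thesis by simp
qed

section \<open>Explicit form of the coefficients of the differential equation\<close>

lemma to_fract_smult_half: "2 * to_fract (smult (1 / 2) p :: complex poly) = to_fract p"
proof -
  have "2 * to_fract (smult (1 / 2) p) = to_fract (smult (1 / 2) p + smult (1 / 2) p)"
    by (simp only: to_fract_add mult_2)
  also have "smult (1 / 2) p + smult (1 / 2) p = p"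
    by (simp flip: smult_add_left)
  finally show ?thesis .
qed

text \<open>Thus \<open>a\<close> is the logarithmic derivative of \<open>x * sqrt p6 / p3\<close>;
  doubling clears the square root.\<close>

lemma a_eq: "2 * a = 2 / to_fract X - 2 * to_fract (pderiv p3) / to_fract p3
    + to_fract (pderiv p6) / to_fract p6"
proof -
  have "2 * to_fract p9 = 2 * (to_fract p3 - to_fract X * to_fract (pderiv p3)) * to_fract p6
      + to_fract X * to_fract p3 * to_fract (pderiv p6)"
    unfolding P9_def to_fract_add distrib_left to_fract_smult_half to_fract_mult to_fract_diff
    by (simp add: algebra_simps)
  moreover have "2 * a = 2 * to_fract p9 / (to_fract X * to_fract p6 * to_fract p3)"
    by (simp add: coeff_a_def Fract_conv_to_fract del: mult_pCons_left mult_pCons_right)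
  ultimately show ?thesis
    using p3_neq_0 p6_neq_0 by (simp add: divide_simps) (simp add: algebra_simps)
qed

lemma b_eq: "16 * b = 4 * to_fract p3 * to_fract q3 / ((to_fract X)\<^sup>2 * to_fract p6)"
proof -
  have "to_fract (4 * X\<^sup>2 * p6) = 4 * (to_fract X)\<^sup>2 * to_fract p6"
    by (simp add: power2_eq_square del: mult_pCons_left mult_pCons_right)
  then show ?thesis
    using p6_neq_0 by (simp add: coeff_b_def Fract_conv_to_fract divide_simps)
qed

lemma hess_R_eq: "4 * hess_R A B h p1 d1 = 2 * rat_deriv a + a\<^sup>2 - 4 * b"
proof -
  have "4 * (u * r + v * s - w) = 2 * r + s - 4 * w" if "4 * u = 2" "4 * v = 1" for u v r s w :: ratfun
  proof -
    have "4 * (u * r + v * s - w) = (4 * u) * r + (4 * v) * s - 4 * w" by (simp add: algebra_simps)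
    then show ?thesis by (simp add: that)
  qed
  moreover have "4 * (1 / 2) = (2 :: ratfun)" "4 * (1 / 4) = (1 :: ratfun)" by (simp_all add: divide_simps)
  ultimately show ?thesis unfolding hess_R_def Let_def by blast
qed

definition rat_ode :: "ratfun \<Rightarrow> ratfun \<Rightarrow> bool"
  where "rat_ode s \<sigma> \<longleftrightarrow> s \<noteq> 0 \<and> \<sigma> = rat_deriv s / s - 2 / to_fract X \<and>
    4 * rat_deriv \<sigma> + \<sigma>\<^sup>2 + 4 * a * \<sigma> + 16 * b = 4 * (to_fract p3)\<^sup>2 / (s * to_fract p6)"

text \<open>The choice of \<open>s\<close> gives 2 \<phi> = \<sigma> + 2 a. Inserted into D = 4 R -
  \<phi> * \<phi> - 2 \<phi>', this cancels the terms \<open>a^2\<close> and \<open>2 a'\<close> of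
  \<open>4 R\<close>, and the left side of the equation becomes \<open>- 4 D\<close>, which is the
  right side by definition of \<open>s\<close>.\<close>

lemma type2_imp_rat_ode:
  assumes "has_type2_solution (hess_R A B h p1 d1)"
  obtains s \<sigma> where "rat_ode s \<sigma>"
proof -
  obtain D \<phi> where D: "D \<noteq> 0" "rat_deriv D = - 2 * \<phi> * D"
    "D = 4 * hess_R A B h p1 d1 - \<phi>\<^sup>2 - 2 * rat_deriv \<phi>"
    using type2_discriminant [OF assms] by metis
  define s where "s = - (to_fract p3)\<^sup>2 / (D * to_fract p6)"
  define \<sigma> where "\<sigma> = rat_deriv s / s - 2 / to_fract X"
  have s0: "s \<noteq> 0" using D(1) p3_neq_0 p6_neq_0 by (simp add: s_def)
  have "rat_deriv s / s = 2 * rat_deriv (to_fract p3) / to_fract p3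
      - rat_deriv (to_fract p6) / to_fract p6 + 2 * \<phi>"
    using p3_neq_0 p6_neq_0 by (intro rational_log_deriv_eq [OF D(1,2) _ _ s_def]) auto
  then have \<phi>: "2 * \<phi> = \<sigma> + 2 * a"
    unfolding \<sigma>_def a_eq by (simp add: algebra_simps)
  have "rat_deriv (2 * \<phi>) = 2 * rat_deriv \<phi>" by (simp add: rat_deriv_mult)
  then have "2 * rat_deriv \<phi> = rat_deriv \<sigma> + 2 * rat_deriv a"
    unfolding \<phi> by (simp add: rat_deriv_add rat_deriv_mult)
  then have "4 * rat_deriv \<sigma> + \<sigma>\<^sup>2 + 4 * a * \<sigma> + 16 * b = - 4 * D"
    using \<phi> D(3) hess_R_eq by algebra
  also have "\<dots> = 4 * (to_fract p3)\<^sup>2 / (s * to_fract p6)"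
    using D(1) p3_neq_0 p6_neq_0 by (simp add: s_def)
  finally show ?thesis using that s0 \<sigma>_def unfolding rat_ode_def by blast
qed

end

section \<open>Solving the equation for \<open>s\<close>\<close>

context hess_simple_roots
begin

section \<open>Residues and double-pole coefficients at finite points\<close>

lemma a_value:
  "has_rat_value (to_fract [:-z, 1:] * a) z
    (of_nat (order z X) - of_nat (order z p3) + of_nat (order z p6) / 2)"
proof -
  define t where "t = to_fract [:-z, 1:]"
  obtain e0 where e0: "has_rat_value e0 z (of_nat (order z X))" "e0 = t * (to_fract (pderiv X) / to_fract X)"
    unfolding t_def by (rule rat_log_deriv_value [of X z]) simp
  obtain e3 where e3: "has_rat_value e3 z (of_nat (order z p3))" "e3 = t * (to_fract (pderiv p3) / to_fract p3)"
    unfolding t_def by (rule rat_log_deriv_value [OF p3_neq_0, of z])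
  obtain e6 where e6: "has_rat_value e6 z (of_nat (order z p6))" "e6 = t * (to_fract (pderiv p6) / to_fract p6)"
    unfolding t_def by (rule rat_log_deriv_value [OF p6_neq_0, of z])
  have X': "pderiv X = 1" by (simp add: pderiv_pCons one_pCons)
  have "t * (2 * a) = 2 * e0 - 2 * e3 + e6"
    unfolding a_eq e0(2) e3(2) e6(2) X' by (simp add: algebra_simps)
  then have "t * a = (2 * e0 - 2 * e3 + e6) / 2"
    by (simp add: eq_divide_eq mult.commute mult.left_commute)
  moreover have "has_rat_value ((2 * e0 - 2 * e3 + e6) / 2) z
      ((2 * of_nat (order z X) - 2 * of_nat (order z p3) + of_nat (order z p6)) / 2)"
    by (intro has_rat_value_divide has_rat_value_intros e0 e3 e6) simp
  ultimately show ?thesis unfolding t_def by (simp add: diff_divide_distrib add_divide_distrib)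
qed

lemma rat_value_divide_p6: obtains c where "has_rat_value (to_fract [:-z, 1:] / to_fract p6) z c"
  using rat_value_divide_order_le [OF p6_neq_0, of z 1] order_p3_p6 [of z] by auto

text \<open>At 0 the constant terms satisfy \<open>p3 * q3 = - p6\<close>, whence
  \<open>- 4\<close>. Elsewhere only the simple roots of \<open>p6\<close> can give poles, so there
  is no double pole.\<close>

lemma b_value:
  "has_rat_value ((to_fract [:-z, 1:])\<^sup>2 * (16 * b)) z (if z = 0 then - 4 else 0)"
proof (cases "z = 0")
  case True
  have "(to_fract X)\<^sup>2 * (16 * b) = 4 * to_fract p3 * to_fract q3 / to_fract p6"
    unfolding b_eq using p6_neq_0 by simp
  moreover have "has_rat_value (4 * to_fract p3 * to_fract q3 / to_fract p6) 0
      (4 * poly p3 0 * poly q3 0 / poly p6 0)"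
    by (intro has_rat_value_divide has_rat_value_intros poly_0_neq_0)
  moreover have "4 * poly p3 0 * poly q3 0 = - 4 * poly p6 0"
    by (simp add: p3_eq q3_eq p6_eq power2_eq_square algebra_simps)
  ultimately show ?thesis
    using True poly_0_neq_0 by simp
next
  case False
  define t where "t = to_fract [:-z, 1:]"
  obtain c where c: "has_rat_value (t / to_fract p6) z c"
    unfolding t_def by (rule rat_value_divide_p6)
  have "t\<^sup>2 * (16 * b) = t * (4 * to_fract p3 * to_fract q3 / (to_fract X)\<^sup>2) * (t / to_fract p6)"
    unfolding b_eq by (simp add: power2_eq_square)
  moreover have "has_rat_value (t * (4 * to_fract p3 * to_fract q3 / (to_fract X)\<^sup>2) * (t / to_fract p6)) z
     (poly [:-z, 1:] z * (4 * poly p3 z * poly q3 z / (poly X z)\<^sup>2) * c)"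
    unfolding t_def
    by (intro has_rat_value_mult has_rat_value_divide has_rat_value_intros c [unfolded t_def]) (use False in simp)
  ultimately show ?thesis using False by (simp add: t_def)
qed

lemma sigma_value:
  assumes "f \<noteq> 0" "g \<noteq> 0" "s = to_fract f / to_fract g"
  shows "has_rat_value (to_fract [:-z, 1:] * (rat_deriv s / s - 2 / to_fract X)) z
    (of_nat (order z f) - of_nat (order z g) - 2 * of_nat (order z X))"
proof -
  define t where "t = to_fract [:-z, 1:]"
  obtain e0 where e0: "has_rat_value e0 z (of_nat (order z X))" "e0 = t * (to_fract (pderiv X) / to_fract X)"
    unfolding t_def by (rule rat_log_deriv_value [of X z]) simp
  obtain ef where ef: "has_rat_value ef z (of_nat (order z f))" "ef = t * (to_fract (pderiv f) / to_fract f)"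
    unfolding t_def by (rule rat_log_deriv_value [OF assms(1), of z])
  obtain eg where eg: "has_rat_value eg z (of_nat (order z g))" "eg = t * (to_fract (pderiv g) / to_fract g)"
    unfolding t_def by (rule rat_log_deriv_value [OF assms(2), of z])
  have X': "pderiv X = 1" by (simp add: pderiv_pCons one_pCons)
  have "rat_deriv s / s = to_fract (pderiv f) / to_fract f - to_fract (pderiv g) / to_fract g"
    using assms(1,2) unfolding assms(3) by (simp add: rat_deriv_frac divide_simps power2_eq_square)
  then have "t * (rat_deriv s / s - 2 / to_fract X) = ef - eg - 2 * e0"
    unfolding e0(2) ef(2) eg(2) X' by (simp only: right_diff_distrib) simp
  moreover have "has_rat_value (ef - eg - 2 * e0) z
      (of_nat (order z f) - of_nat (order z g) - 2 * of_nat (order z X))"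
    by (intro has_rat_value_intros e0 ef eg)
  ultimately show ?thesis by (simp add: t_def)
qed

lemma order_X: "order z X = (if z = 0 then 1 else 0)"
  using order_root [of X z] order_power_n_n [of 0 1] by auto

text \<open>At a pole of \<open>s\<close> of order \<open>k\<close> the right side of the equation
  has no double pole, and the indicial equation becomes \<open>k\<close> times a positive number
  equal to 0.\<close>

lemma rat_ode_polynomial:
  assumes "rat_ode s \<sigma>"
  obtains f where "f \<noteq> 0" "s = to_fract f"
proof -
  obtain f g where fg: "s = to_fract f / to_fract g" "g \<noteq> 0" "coprime f g"
    by (rule ratfun_cases)
  have s: "s \<noteq> 0" "\<sigma> = rat_deriv s / s - 2 / to_fract X"
    and eq: "4 * rat_deriv \<sigma> + \<sigma>\<^sup>2 + 4 * a * \<sigma> + 16 * b = 4 * (to_fract p3)\<^sup>2 / (s * to_fract p6)"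
    using assms by (auto simp: rat_ode_def)
  have f: "f \<noteq> 0" using s fg by auto
  have no_root: "poly g z \<noteq> 0" for z
  proof
    assume g: "poly g z = 0"
    then have fz: "poly f z \<noteq> 0" using fg(3) by (metis coprime_poly_0)
    define t where "t = to_fract [:-z, 1:]"
    define k where "k = order z g"
    have k: "k > 0" using g fg(2) by (simp add: k_def order_root)
    have of: "order z f = 0" using fz by (simp add: order_0I)
    obtain c where c: "has_rat_value (t / to_fract p6) z c"
      unfolding t_def by (rule rat_value_divide_p6)
    have "t\<^sup>2 * (4 * (to_fract p3)\<^sup>2 / (s * to_fract p6))
        = t * (4 * (to_fract p3)\<^sup>2 * to_fract g / to_fract f) * (t / to_fract p6)"
      by (simp add: fg(1) power2_eq_square)
    moreover have "has_rat_value (t * (4 * (to_fract p3)\<^sup>2 * to_fract g / to_fract f) * (t / to_fract p6)) z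
       (poly [:-z, 1:] z * (4 * (poly p3 z)\<^sup>2 * poly g z / poly f z) * c)"
      unfolding t_def
      by (intro has_rat_value_mult has_rat_value_divide has_rat_value_intros c [unfolded t_def] fz)
    ultimately have r: "has_rat_value (t\<^sup>2 * (4 * (to_fract p3)\<^sup>2 / (s * to_fract p6))) z 0"
      by simp
    have ind: "(of_nat (order z f) - of_nat (order z g) - 2 * of_nat (order z X))\<^sup>2
        - 4 * (of_nat (order z f) - of_nat (order z g) - 2 * of_nat (order z X))
        + 4 * (of_nat (order z X) - of_nat (order z p3) + of_nat (order z p6) / 2)
            * (of_nat (order z f) - of_nat (order z g) - 2 * of_nat (order z X))
        + (if z = 0 then - 4 else 0) = (0 :: complex)"
      using indicial_equation [OF eq sigma_value [OF f fg(2,1), folded s(2)] a_value b_value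
          r [unfolded t_def]] .
    show False
    proof (cases "z = 0")
      case True
      then have "order z p3 = 0" "order z p6 = 0"
        using poly_0_neq_0 by (auto simp: order_0I)
      \<comment> \<open>Here \<sigma> has residue \<open>- k - 2\<close>, \<open>a\<close> has
        residue 1 and the term with \<open>b\<close> contributes \<open>- 4\<close>. Writing the
        result as an embedded real number makes positivity available.\<close>
      then have "complex_of_real (of_nat k * (of_nat k + 4)) = 0"
        using ind of unfolding k_def [symmetric] by (simp add: True order_X power2_eq_square algebra_simps)
      then show False using k by (simp only: of_real_eq_0_iff) (auto simp: add_eq_0_iff)
    next
      case False
      \<comment> \<open>Now the residue of \<sigma> is \<open>- k\<close>. Since \<open>p6\<close>
        has order at most 1, the second factor is positive.\<close>
      then have "complex_of_real (of_nat k * (of_nat k + 4 + 4 * of_nat (order z p3) - 2 * of_nat (order z p6))) = 0"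
        using ind of by (simp add: order_X k_def [symmetric] power2_eq_square algebra_simps)
      moreover have "of_nat k + 4 + 4 * of_nat (order z p3) - 2 * of_nat (order z p6) > (0 :: real)"
        using order_p3_p6 [of z] by (cases "order z p6") auto
      ultimately show False using k by (simp only: of_real_eq_0_iff) simp
    qed
  qed
  then have "degree g = 0"
    using alg_closed_imp_poly_has_root [of g] by blast
  then obtain c where c: "g = [:c:]" "c \<noteq> 0"
    using fg(2) by (metis degree_eq_zeroE pCons_eq_0_iff)
  have "f = smult (1 / c) f * g" using c by simp
  then have "to_fract f = to_fract (smult (1 / c) f) * to_fract g" by (metis to_fract_mult)
  then have "s = to_fract (smult (1 / c) f)"
    using fg(1,2) by simp
  then show ?thesis using that [of "smult (1 / c) f"] f c by simp
qed

text \<open>At such a root \<open>a\<close> has residue \<open>- 1\<close>, so a zero of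
  \<open>f\<close> of order \<open>k\<close> would satisfy \<open>k * (k - 8) = 0\<close>, whereas
  \<open>k\<close> is 1 or 2. The degree bound also keeps the right side free of a double
  pole.\<close>

lemma rat_ode_no_p3_root:
  assumes "rat_ode s \<sigma>" "s = to_fract f" "degree f \<le> 2" "poly p3 z = 0"
  shows "poly f z \<noteq> 0"
proof
  assume fz: "poly f z = 0"
  have s: "s \<noteq> 0" "\<sigma> = rat_deriv s / s - 2 / to_fract X"
    and eq: "4 * rat_deriv \<sigma> + \<sigma>\<^sup>2 + 4 * a * \<sigma> + 16 * b = 4 * (to_fract p3)\<^sup>2 / (s * to_fract p6)"
    using assms by (auto simp: rat_ode_def)
  have f: "f \<noteq> 0" using s assms by auto
  define k where "k = order z f"
  have k: "k > 0" "k \<le> 2"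
    using fz f assms(3) order_degree [OF f, of z] by (auto simp: k_def order_root)
  have p6: "poly p6 z \<noteq> 0" by (rule p3_p6_no_common_root) fact
  then have o6: "order z p6 = 0" by (simp add: order_0I)
  have z: "z \<noteq> 0" using assms(4) poly_0_neq_0 by auto
  define t where "t = to_fract [:-z, 1:]"
  obtain c where c: "has_rat_value (t ^ 2 / to_fract f) z c"
    unfolding t_def by (rule rat_value_divide_order_le [OF f k(2) [unfolded k_def]])
  have "t\<^sup>2 * (4 * (to_fract p3)\<^sup>2 / (s * to_fract p6)) = 4 * (to_fract p3)\<^sup>2 / to_fract p6 * (t ^ 2 / to_fract f)"
    by (simp add: assms(2) ac_simps)
  moreover have "has_rat_value (4 * (to_fract p3)\<^sup>2 / to_fract p6 * (t ^ 2 / to_fract f)) z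
      (4 * (poly p3 z)\<^sup>2 / poly p6 z * c)"
    by (intro has_rat_value_mult has_rat_value_divide has_rat_value_intros c p6)
  ultimately have r: "has_rat_value (t\<^sup>2 * (4 * (to_fract p3)\<^sup>2 / (s * to_fract p6))) z 0"
    using assms(4) by simp
  have s1: "s = to_fract f / to_fract 1" by (simp add: assms(2))
  have "(of_nat (order z f) - of_nat (order z 1) - 2 * of_nat (order z X))\<^sup>2
      - 4 * (of_nat (order z f) - of_nat (order z 1) - 2 * of_nat (order z X))
      + 4 * (of_nat (order z X) - of_nat (order z p3) + of_nat (order z p6) / 2)
          * (of_nat (order z f) - of_nat (order z 1) - 2 * of_nat (order z X))
      + (if z = 0 then - 4 else 0) = (0 :: complex)"
    using indicial_equation [OF eq sigma_value [OF f one_neq_zero s1, folded s(2)] a_value b_value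
        r [unfolded t_def]] .
  then have "of_nat k * of_nat k - 8 * of_nat k = (0 :: complex)"
    using z o6 order_root_p3 [OF assms(4)]
    by (simp add: order_X order_0I k_def [symmetric] power2_eq_square algebra_simps)
  moreover have "k = 1 \<or> k = 2" using k by auto
  ultimately show False by auto
qed

text \<open>This is the numerator of \<sigma>, which equals \<open>euler_defect f / (x * f)\<close>
  when \<open>s\<close> is the polynomial \<open>f\<close>. It vanishes exactly on the multiples of
  \<open>x^2\<close>.\<close>

definition euler_defect :: "complex poly \<Rightarrow> complex poly"
  where "euler_defect f = X * pderiv f - 2 * f"

text \<open>The equation for \<sigma> is multiplied by \<open>x^2 * f^2 * p3 * p6\<close>, which
  clears all denominators.\<close>

lemma rat_ode_imp_poly_ode:
  assumes "rat_ode s \<sigma>" "s = to_fract f"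
  defines "\<tau> \<equiv> euler_defect f"
  shows "p3 * p6 * (4 * (f * (X * pderiv \<tau>) - \<tau> * (f + X * pderiv f)) + \<tau> * \<tau>) + 4 * (p9 * (\<tau> * f))
    + 4 * (p3 * p3 * q3 * (f * f)) = 4 * (p3 * p3 * p3 * (f * (X * X)))"
proof -
  have s: "s \<noteq> 0" "\<sigma> = rat_deriv s / s - 2 / to_fract X"
    and eq: "4 * rat_deriv \<sigma> + \<sigma>\<^sup>2 + 4 * a * \<sigma> + 16 * b = 4 * (to_fract p3)\<^sup>2 / (s * to_fract p6)"
    using assms by (auto simp: rat_ode_def)
  have f: "f \<noteq> 0" using s assms by auto
  have dX: "pderiv X = 1" by (simp add: pderiv_pCons one_pCons)
  define x P Q where "x = to_fract X" "P = to_fract p3" "Q = to_fract p6"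
  define T T' s' where "T = to_fract \<tau>" "T' = to_fract (pderiv \<tau>)" "s' = to_fract (pderiv f)"
  have nz: "x \<noteq> 0" "P \<noteq> 0" "Q \<noteq> 0" "s \<noteq> 0"
    using p3_neq_0 p6_neq_0 s by (simp_all add: x_P_Q_def)
  have T: "T = x * s' - 2 * s"
    by (simp only: T_T'_s'_def x_P_Q_def \<tau>_def euler_defect_def assms(2) to_fract_mult to_fract_diff to_fract_numeral)
  have "\<sigma> = T / (x * s)"
    using nz unfolding s(2) T by (simp add: assms(2) x_P_Q_def T_T'_s'_def divide_simps)
  moreover have "rat_deriv (T / (x * s)) = (T' * (x * s) - T * (s + x * s')) / (x * s)\<^sup>2"
    using nz by (simp add: rat_deriv_divide rat_deriv_mult assms(2) x_P_Q_def T_T'_s'_def dX del: mult_pCons_left)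
  ultimately have \<sigma>: "\<sigma> * (x * s) = T" "rat_deriv \<sigma> * (x * s)\<^sup>2 = T' * (x * s) - T * (s + x * s')"
    using nz by simp_all
  have a: "a * (x * Q * P) = to_fract p9"
    using nz by (simp add: coeff_a_def Fract_conv_to_fract x_P_Q_def del: mult_pCons_left)
  have b: "16 * b * (x\<^sup>2 * Q) = 4 * P * to_fract q3"
    using nz unfolding b_eq x_P_Q_def by simp
  have r: "4 * P\<^sup>2 / (s * Q) * (s * Q) = 4 * P\<^sup>2"
    using nz by simp
  have "(4 * rat_deriv \<sigma> + \<sigma>\<^sup>2 + 4 * a * \<sigma> + 16 * b) * (x\<^sup>2 * s\<^sup>2 * P * Q)
    = 4 * P\<^sup>2 / (s * Q) * (s * Q) * (s * x\<^sup>2 * P)"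
    unfolding eq x_P_Q_def by (simp add: power2_eq_square)
  then have "P * Q * (4 * (s * (x * T') - T * (s + x * s')) + T * T) + 4 * (to_fract p9 * (T * s))
    + 4 * (P * P * to_fract q3 * (s * s)) = 4 * (P * P * P * (s * (x * x)))"
    unfolding r using \<sigma> a b by algebra
  then show ?thesis
    unfolding x_P_Q_def T_T'_s'_def assms(2)
    by (simp only: to_fract_eq_iff flip: to_fract_mult to_fract_add to_fract_diff to_fract_numeral)
qed

section \<open>Behaviour at infinity\<close>

lemma top_coeff_p9: "top_coeff 9 p9 (of_real (2 * d1))"
proof -
  have 3: "top_coeff 3 p3 (of_real (2 * d1))" and 6: "top_coeff 6 p6 1"
    by (simp_all add: top_coeff_def p3_eq p6_eq eval_nat_numeral)
  have "p9 = (p3 - X * pderiv p3) * p6 + smult (1 / 2) (p3 * (X * pderiv p6))"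
    unfolding P9_def by (simp add: ac_simps)
  moreover have "top_coeff (3 + 6) ((p3 - X * pderiv p3) * p6 + smult (1 / 2) (p3 * (X * pderiv p6)))
     ((of_real (2 * d1) - of_nat 3 * of_real (2 * d1)) * 1 + 1 / 2 * (of_real (2 * d1) * (of_nat 6 * 1)))"
    by (intro top_coeff_add top_coeff_mult top_coeff_diff top_coeff_euler top_coeff_smult 3 6)
  ultimately show ?thesis by simp
qed

text \<open>If \<open>N = degree f\<close> exceeds 2, the right side of the polynomial equation has
  degree at most \<open>N + 11 < 2 * N + 9\<close>, so the top coefficient on the left must vanish;
  it is a nonzero multiple of a positive sum of two real squares.\<close>

lemma rat_ode_degree_le:
  assumes "rat_ode s \<sigma>" "s = to_fract f"
  shows "degree f \<le> 2"
proof (rule ccontr)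
  assume "\<not> degree f \<le> 2"
  define N where "N = degree f"
  then have N: "N > 2" using \<open>\<not> _\<close> by simp
  define l where "l = lead_coeff f"
  have l: "l \<noteq> 0" using N by (auto simp: l_def N_def)
  have f: "top_coeff N f l" by (simp add: top_coeff_def N_def l_def)
  define \<delta> where "\<delta> = complex_of_real (2 * d1)"
  define \<tau> where "\<tau> = euler_defect f"
  have \<tau>: "top_coeff N \<tau> (of_nat N * l - 2 * l)"
    unfolding \<tau>_def euler_defect_def by (intro top_coeff_diff top_coeff_euler top_coeff_numeral_mult f)
  have 3: "top_coeff 3 p3 \<delta>" "top_coeff 3 q3 \<delta>" and 6: "top_coeff 6 p6 1"
    by (simp_all add: top_coeff_def p3_eq p6_eq q3_eq \<delta>_def eval_nat_numeral)
  have "top_coeff (9 + (N + N)) (p3 * p6 * (4 * (f * (X * pderiv \<tau>) - \<tau> * (f + X * pderiv f)) + \<tau> * \<tau>)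
      + 4 * (p9 * (\<tau> * f)) + 4 * (p3 * p3 * q3 * (f * f)))
    (\<delta> * 1 * (4 * (l * (of_nat N * (of_nat N * l - 2 * l)) - (of_nat N * l - 2 * l) * (l + of_nat N * l))
        + (of_nat N * l - 2 * l) * (of_nat N * l - 2 * l))
      + 4 * (\<delta> * ((of_nat N * l - 2 * l) * l)) + 4 * (\<delta> * \<delta> * \<delta> * (l * l)))"
  proof (intro top_coeff_add top_coeff_numeral_mult)
    show "top_coeff (9 + (N + N)) (p9 * (\<tau> * f)) (\<delta> * ((of_nat N * l - 2 * l) * l))"
      using top_coeff_p9 unfolding \<delta>_def by (intro top_coeff_mult \<tau> f)
    have "top_coeff (3 + 3 + 3 + (N + N)) (p3 * p3 * q3 * (f * f)) (\<delta> * \<delta> * \<delta> * (l * l))"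
      by (intro top_coeff_mult 3 f)
    then show "top_coeff (9 + (N + N)) (p3 * p3 * q3 * (f * f)) (\<delta> * \<delta> * \<delta> * (l * l))" by simp
    have "top_coeff (3 + 6 + (N + N)) (p3 * p6 * (4 * (f * (X * pderiv \<tau>) - \<tau> * (f + X * pderiv f)) + \<tau> * \<tau>))
     (\<delta> * 1 * (4 * (l * (of_nat N * (of_nat N * l - 2 * l)) - (of_nat N * l - 2 * l) * (l + of_nat N * l))
        + (of_nat N * l - 2 * l) * (of_nat N * l - 2 * l)))"
      by (intro top_coeff_mult top_coeff_add top_coeff_diff top_coeff_numeral_mult top_coeff_euler 3 6 \<tau> f)
    then show "top_coeff (9 + (N + N)) (p3 * p6 * (4 * (f * (X * pderiv \<tau>) - \<tau> * (f + X * pderiv f)) + \<tau> * \<tau>))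
     (\<delta> * 1 * (4 * (l * (of_nat N * (of_nat N * l - 2 * l)) - (of_nat N * l - 2 * l) * (l + of_nat N * l))
        + (of_nat N * l - 2 * l) * (of_nat N * l - 2 * l)))" by simp
  qed
  moreover have "top_coeff (9 + (N + N)) (4 * (p3 * p3 * p3 * (f * (X * X)))) 0"
  proof -
    have X2: "top_coeff 2 (X * X) 1" by (simp add: top_coeff_def numeral_2_eq_2)
    have "top_coeff (3 + 3 + 3 + (N + 2)) (4 * (p3 * p3 * p3 * (f * (X * X)))) (4 * (\<delta> * \<delta> * \<delta> * (l * 1)))"
      by (intro top_coeff_numeral_mult top_coeff_mult 3 f X2)
    then show ?thesis using N by (auto simp: top_coeff_def intro!: coeff_eq_0)
  qed
  ultimately have "\<delta> * 1 * (4 * (l * (of_nat N * (of_nat N * l - 2 * l)) - (of_nat N * l - 2 * l) * (l + of_nat N * l))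
        + (of_nat N * l - 2 * l) * (of_nat N * l - 2 * l))
      + 4 * (\<delta> * ((of_nat N * l - 2 * l) * l)) + 4 * (\<delta> * \<delta> * \<delta> * (l * l)) = 0"
    unfolding rat_ode_imp_poly_ode [OF assms, folded \<tau>_def] by (rule top_coeff_unique)
  \<comment> \<open>The terms \<open>- 4 (N - 2)\<close> from the derivative and
    \<open>4 (N - 2)\<close> from \<open>p9\<close> cancel, leaving only squares.\<close>
  then have "\<delta> * l\<^sup>2 * ((of_nat N - 2)\<^sup>2 + (2 * \<delta>)\<^sup>2) = 0"
    by algebra
  then have "(of_nat N - 2)\<^sup>2 + (2 * \<delta>)\<^sup>2 = 0"
    using l d1 by (simp add: \<delta>_def)
  then have "complex_of_real ((of_nat N - 2)\<^sup>2 + (4 * d1)\<^sup>2) = 0"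
    by (simp add: \<delta>_def)
  then have "(of_nat N - 2)\<^sup>2 + (4 * d1)\<^sup>2 = 0"
    by (simp only: of_real_eq_0_iff)
  then show False using d1 by (simp only: sum_power2_eq_zero_iff) simp
qed

lemma rat_ode_euler_defect_eq_0:
  assumes "rat_ode s \<sigma>" "s = to_fract f"
  shows "euler_defect f = 0"
proof (rule ccontr)
  define \<tau> where "\<tau> = euler_defect f"
  assume "euler_defect f \<noteq> 0"
  then have \<tau>0: "\<tau> \<noteq> 0" by (simp add: \<tau>_def)
  have deg: "degree f \<le> 2" using assms by (rule rat_ode_degree_le)
  then have "top_coeff 2 f (coeff f 2)" by (simp add: top_coeff_def)
  then have "top_coeff 2 \<tau> (of_nat 2 * coeff f 2 - 2 * coeff f 2)"
    unfolding \<tau>_def euler_defect_def by (intro top_coeff_diff top_coeff_euler top_coeff_numeral_mult)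
  \<comment> \<open>The coefficient of \<open>x^2\<close> cancels as \<open>2 - 2\<close>, so \<tau>
    has degree at most 1 and cannot have three roots.\<close>
  then have "degree \<tau> \<le> 2" "coeff \<tau> 2 = 0" by (simp_all add: top_coeff_def)
  then have d\<tau>: "degree \<tau> < 2"
    using \<tau>0 by (metis leading_coeff_0_iff order_le_less)
  have "poly \<tau> z = 0" if z: "poly p3 z = 0" for z
  proof -
    have "poly (p3 * p6 * (4 * (f * (X * pderiv \<tau>) - \<tau> * (f + X * pderiv f)) + \<tau> * \<tau>) + 4 * (p9 * (\<tau> * f))
        + 4 * (p3 * p3 * q3 * (f * f))) z = poly (4 * (p3 * p3 * p3 * (f * (X * X)))) z"
      using rat_ode_imp_poly_ode [OF assms] by (simp only: \<tau>_def)
    \<comment> \<open>Every other term of the polynomial equation contains the factor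
      \<open>p3\<close>.\<close>
    then have "poly p9 z * (poly \<tau> z * poly f z) = 0"
      using z by simp
    moreover have "poly f z \<noteq> 0"
      using rat_ode_no_p3_root [OF assms deg z] .
    \<comment> \<open>At a root of \<open>p3\<close> one has \<open>p9 = - z * p3' * p6\<close>,
      with all three factors nonzero because the root is simple, nonzero and not shared with
      \<open>p6\<close>.\<close>
    moreover have "poly p9 z \<noteq> 0"
    proof -
      have "z \<noteq> 0" using z poly_0_neq_0 by auto
      moreover have "poly (pderiv p3) z \<noteq> 0"
        using order_root_p3 [OF z] order_pderiv [of p3 z] order_root [of "pderiv p3" z] p3_neq_0 degree_p3 z
        by (simp add: pderiv_eq_0_iff)
      ultimately show ?thesis
        using z p3_p6_no_common_root [OF z] by (simp add: P9_def)
    qed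
    ultimately show ?thesis by simp
  qed
  then have "card {z. poly p3 z = 0} \<le> card {z. poly \<tau> z = 0}"
    using \<tau>0 by (intro card_mono poly_roots_finite) auto
  also have "\<dots> \<le> degree \<tau>" using \<tau>0 by (rule card_poly_roots_bound)
  finally show False using card_roots_p3 d\<tau> by simp
qed

lemma rat_ode_parameters:
  assumes "rat_ode s \<sigma>"
  shows "p1 = B * h \<and> B = 2 * A"
proof -
  obtain f where f: "f \<noteq> 0" "s = to_fract f"
    by (rule rat_ode_polynomial [OF assms])
  have \<tau>: "euler_defect f = 0" by (rule rat_ode_euler_defect_eq_0 [OF assms f(2)])
  have "coeff f i = 0" if "i \<noteq> 2" for i
  proof -
    \<comment> \<open>The monomials are eigenvectors of the Euler operator, so only
      \<open>x^2\<close> survives.\<close>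
    have "coeff (euler_defect f) i = (of_nat i - 2) * coeff f i"
      unfolding euler_defect_def
      by (cases i) (simp_all add: coeff_pderiv numeral_poly algebra_simps)
    then have "(of_nat i - of_nat 2) * coeff f i = 0" using \<tau> by simp
    then show ?thesis using that by (simp only: mult_eq_0_iff right_minus_eq of_nat_eq_iff) simp
  qed
  then have f2: "f = smult (coeff f 2) (X * X)"
    by (intro poly_eqI) (auto simp: coeff_pCons numeral_2_eq_2 split: nat.splits)
  define \<kappa> where "\<kappa> = coeff f 2"
  have "4 * (p3 * p3 * q3 * (f * f)) = 4 * (p3 * p3 * p3 * (f * (X * X)))"
    using rat_ode_imp_poly_ode [OF assms f(2)] \<tau> by simp
  then have "(4 * p3 * p3 * f) * (q3 * f) = (4 * p3 * p3 * f) * (p3 * (X * X))"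
    by (simp only: ac_simps)
  then have "q3 * f = p3 * (X * X)"
    using p3_neq_0 f(1) unfolding mult_cancel_left by simp
  then have "(X * X) * smult \<kappa> q3 = (X * X) * p3"
    by (subst (asm) f2) (simp add: \<kappa>_def ac_simps)
  then have "smult \<kappa> q3 = p3" by simp
  \<comment> \<open>Since \<open>q3 = 4 d1 x^3 - p3\<close>, the cubic coefficients of
    \<open>q3\<close> and \<open>p3\<close> agree and force \<kappa> = 1, while the other
    coefficients are opposite and hence vanish.\<close>
  then have "\<kappa> * of_real (2 * d1) = of_real (2 * d1)"
    and "\<kappa> * - of_real (2 * (B * h - p1)) = of_real (2 * (B * h - p1))"
    and "\<kappa> * - of_real (B - 2 * A) = of_real (B - 2 * A)"
    unfolding p3_eq q3_eq by (auto simp del: of_real_mult of_real_diff of_real_eq_0_iff)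
  moreover from this have "\<kappa> = 1" using d1 by simp
  moreover have "c = 0" if "- c = c" for c :: complex
    using that by (simp add: complex_eq_iff)
  ultimately have "complex_of_real (2 * (B * h - p1)) = 0" "complex_of_real (B - 2 * A) = 0"
    by (simp_all only: mult_1_left)
  then show ?thesis by (simp only: of_real_eq_0_iff) simp
qed

end

theorem theorem5:
  fixes A B p1 h d1 :: real
  assumes "h \<ge> -1" and "-1 < d1" and "d1 \<le> 0" and "d1 \<noteq> 0"
    and "card {z :: complex. poly (P3 A B h p1 d1 * P6 B h p1) z = 0} = 9"
    and "has_type2_solution (hess_R A B h p1 d1)"
  shows "p1 = B * h \<and> B = 2 * A"
proof -
  interpret hess_simple_roots A B h p1 d1
    using assms by unfold_locales
  obtain s \<sigma> where "rat_ode s \<sigma>"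
    using type2_imp_rat_ode [OF assms(6)] .
  then show ?thesis by (rule rat_ode_parameters)
qed

end
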